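(* There are undirected networks over time $N=(G,u,b,\tau)$ with $n$ nodes, for arbitrarily large $n$ and any $T>0$, with either a single source or a single sink, in which all supplies and demands ($B=\sum_{v:\,b_v>0}b_v$ units of flow) can be sent within time horizon $T+1$, but in every orientation $\overrightarrow{N}$ of $N$ sending $B$ units of flow requires a time horizon of at least $\frac{n-1}{4}\cdot T$. The same holds for networks in which $G$ is a tree with multiple sources and sinks.
   Context: An undirected network over time $N=(G,u,b,\tau)$ consists of a finite undirected (multi)graph $G=(V,E)$, capacities $u_e\ge0$ (possibly $\infty$), transit times $\tau_e\ge0$, and balances $b_v$ with $\sum_v b_v=0$; sources $S^+=\{v:b_v>0\}$, sinks $S^-=\{v:b_v<0\}$. An orientation replaces each edge $\{v,w\}$ by exactly one of $(v,w),(w,v)$ with the same capacity and transit time. A flow over time with time horizon $\Theta$ in a directed network assigns to each arc a Lebesgue-integrable inflow rate $f_e:[0,\Theta)\to\mathbb{R}_{\ge0}$ with $f_e\le u_e$, $f_e(\theta)=0$ for $\theta\ge\Theta-\tau_e$, flow entering at $\theta$ leaving at $\theta+\tau_e$, satisfying flow conservation (intermediate nodes: no flow remains at the end and excess is never negative; a source $v$ sends out at most $b_v$; a sink $v$ receives at most $-b_v$). Its value is the total amount that has arrived at the sinks by $\Theta$. In an undirected network each edge may be used in both directions, with inflow rates in both directions together bounded by $u_e$. Sending $B$ units within horizon $\Theta$ means a flow over time with horizon $\Theta$ of value $B$ exists. *)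

theory Defs
  imports "HOL-Analysis.Analysis" "Graph_Theory.Digraph"
begin

section \<open>Undirected multigraphs\<close>

text \<open>Parallel edges are distinct edge names with the same set of endpoints.\<close>

record ('v, 'e) multigraph =
  nodes :: "'v set"
  edges :: "'e set"
  ends :: "'e \<Rightarrow> 'v set"

definition finite_multigraph :: "('v, 'e) multigraph \<Rightarrow> bool" where
  "finite_multigraph G \<longleftrightarrow>
     finite (nodes G) \<and> finite (edges G) \<and>
     (\<forall>e\<in>edges G. ends G e \<subseteq> nodes G \<and> card (ends G e) = 2)"

definition connected_multigraph :: "('v, 'e) multigraph \<Rightarrow> bool" where
  "connected_multigraph G \<longleftrightarrow>
     nodes G \<noteq> {} \<and>
     (\<forall>v\<in>nodes G. \<forall>w\<in>nodes G.
        (v, w) \<in> {(x, y). \<exists>e\<in>edges G. ends G e = {x, y}}\<^sup>*)"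

text \<open>
  A cycle visits the pairwise distinct nodes \<open>vs\<close> in cyclic order, using the pairwise distinct
  edges \<open>es\<close>; two parallel edges form a cycle of length 2.
\<close>

definition is_cycle :: "('v, 'e) multigraph \<Rightarrow> 'v list \<Rightarrow> 'e list \<Rightarrow> bool" where
  "is_cycle G vs es \<longleftrightarrow>
     vs \<noteq> [] \<and> length es = length vs \<and> distinct vs \<and> distinct es \<and>
     set vs \<subseteq> nodes G \<and> set es \<subseteq> edges G \<and>
     (\<forall>i<length vs. ends G (es ! i) = {vs ! i, vs ! (Suc i mod length vs)})"

definition is_tree :: "('v, 'e) multigraph \<Rightarrow> bool" where
  "is_tree G \<longleftrightarrow> connected_multigraph G \<and> (\<nexists>vs es. is_cycle G vs es)"


section \<open>Networks over time\<close>

record ('g, 'v, 'e) network =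
  graph :: 'g
  capacity :: "'e \<Rightarrow> ereal"
  balance :: "'v \<Rightarrow> real"
  transit :: "'e \<Rightarrow> real"

type_synonym ('v, 'e) undirected_network = "(('v, 'e) multigraph, 'v, 'e) network"
type_synonym ('v, 'a) directed_network = "(('v, 'a) pre_digraph, 'v, 'a) network"

definition is_undirected_network :: "('v, 'e) undirected_network \<Rightarrow> bool" where
  "is_undirected_network N \<longleftrightarrow>
     finite_multigraph (graph N) \<and>
     (\<forall>e\<in>edges (graph N). 0 \<le> capacity N e \<and> 0 \<le> transit N e) \<and>
     (\<Sum>v\<in>nodes (graph N). balance N v) = 0"

definition sources :: "('v, 'e) undirected_network \<Rightarrow> 'v set" where
  "sources N = {v \<in> nodes (graph N). 0 < balance N v}"

definition sinks :: "('v, 'e) undirected_network \<Rightarrow> 'v set" where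
  "sinks N = {v \<in> nodes (graph N). balance N v < 0}"

definition total_supply :: "('v, 'e) undirected_network \<Rightarrow> real" where
  "total_supply N = (\<Sum>v\<in>sources N. balance N v)"

definition is_orientation ::
    "('v, 'e) undirected_network \<Rightarrow> ('v, 'e) directed_network \<Rightarrow> bool" where
  "is_orientation N D \<longleftrightarrow>
     verts (graph D) = nodes (graph N) \<and> arcs (graph D) = edges (graph N) \<and>
     (\<forall>e\<in>edges (graph N). {tail (graph D) e, head (graph D) e} = ends (graph N) e) \<and>
     capacity D = capacity N \<and> balance D = balance N \<and> transit D = transit N"


section \<open>Flows over time in directed networks\<close>

text \<open>
  The rate \<open>f a\<close> only matters on \<open>{0..<\<Theta>}\<close>. For \<open>\<theta> < transit D a\<close> the first integral ranges over
  the empty set.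
\<close>

definition excess ::
    "('v, 'a) directed_network \<Rightarrow> ('a \<Rightarrow> real \<Rightarrow> real) \<Rightarrow> 'v \<Rightarrow> real \<Rightarrow> real" where
  "excess D f v \<theta> =
     (\<Sum>a\<in>in_arcs (graph D) v. LINT \<xi>:{0..<\<theta> - transit D a}|lebesgue. f a \<xi>) -
     (\<Sum>a\<in>out_arcs (graph D) v. LINT \<xi>:{0..<\<theta>}|lebesgue. f a \<xi>)"

text \<open>
  At a source the net amount sent out so far is \<open>- excess D f v \<theta>\<close>, at a sink the net amount
  received so far is \<open>excess D f v \<theta>\<close>.
\<close>

definition flow_over_time ::
    "('v, 'a) directed_network \<Rightarrow> real \<Rightarrow> ('a \<Rightarrow> real \<Rightarrow> real) \<Rightarrow> bool" where
  "flow_over_time D \<Theta> f \<longleftrightarrow>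
     0 \<le> \<Theta> \<and>
     (\<forall>a\<in>arcs (graph D).
        set_integrable lebesgue {0..<\<Theta>} (f a) \<and>
        (\<forall>\<theta>\<in>{0..<\<Theta>}. 0 \<le> f a \<theta> \<and> ereal (f a \<theta>) \<le> capacity D a \<and>
           (\<Theta> - transit D a \<le> \<theta> \<longrightarrow> f a \<theta> = 0))) \<and>
     (\<forall>v\<in>verts (graph D).
        (balance D v = 0 \<longrightarrow>
           (\<forall>\<theta>\<in>{0..\<Theta>}. 0 \<le> excess D f v \<theta>) \<and> excess D f v \<Theta> = 0) \<and>
        (0 < balance D v \<longrightarrow>
           (\<forall>\<theta>\<in>{0..\<Theta>}. 0 \<le> - excess D f v \<theta> \<and> - excess D f v \<theta> \<le> balance D v)) \<and>
        (balance D v < 0 \<longrightarrow>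
           (\<forall>\<theta>\<in>{0..\<Theta>}. 0 \<le> excess D f v \<theta> \<and> excess D f v \<theta> \<le> - balance D v)))"

definition flow_value ::
    "('v, 'a) directed_network \<Rightarrow> real \<Rightarrow> ('a \<Rightarrow> real \<Rightarrow> real) \<Rightarrow> real" where
  "flow_value D \<Theta> f = (\<Sum>v\<in>{v \<in> verts (graph D). balance D v < 0}. excess D f v \<Theta>)"

definition can_send :: "('v, 'a) directed_network \<Rightarrow> real \<Rightarrow> real \<Rightarrow> bool" where
  "can_send D B \<Theta> \<longleftrightarrow> (\<exists>f. flow_over_time D \<Theta> f \<and> flow_value D \<Theta> f = B)"


section \<open>Flows over time in undirected networks\<close>

text \<open>The arc \<open>(e, v, w)\<close> is the edge \<open>e\<close> used from \<open>v\<close> to \<open>w\<close>.\<close>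

definition bidirected ::
    "('v, 'e) undirected_network \<Rightarrow> ('v, 'e \<times> 'v \<times> 'v) directed_network" where
  "bidirected N =
     \<lparr>graph = \<lparr>verts = nodes (graph N),
               arcs = {(e, v, w). e \<in> edges (graph N) \<and> ends (graph N) e = {v, w}},
               tail = (\<lambda>(e, v, w). v),
               head = (\<lambda>(e, v, w). w)\<rparr>,
      capacity = (\<lambda>(e, v, w). capacity N e),
      balance = balance N,
      transit = (\<lambda>(e, v, w). transit N e)\<rparr>"

definition undirected_flow_over_time ::
    "('v, 'e) undirected_network \<Rightarrow> real \<Rightarrow> ('e \<times> 'v \<times> 'v \<Rightarrow> real \<Rightarrow> real) \<Rightarrow> bool" where
  "undirected_flow_over_time N \<Theta> f \<longleftrightarrow>
     flow_over_time (bidirected N) \<Theta> f \<and>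
     (\<forall>e v w. e \<in> edges (graph N) \<and> ends (graph N) e = {v, w} \<longrightarrow>
        (\<forall>\<theta>\<in>{0..<\<Theta>}. ereal (f (e, v, w) \<theta> + f (e, w, v) \<theta>) \<le> capacity N e))"

definition undirected_can_send :: "('v, 'e) undirected_network \<Rightarrow> real \<Rightarrow> real \<Rightarrow> bool" where
  "undirected_can_send N B \<Theta> \<longleftrightarrow>
     (\<exists>f. undirected_flow_over_time N \<Theta> f \<and> flow_value (bidirected N) \<Theta> f = B)"

end

theory Submission
  imports Defs
begin

text \<open>
  All three families come from one network: a spine \<open>0, \<dots>, k\<close> of edges with transit time \<open>T\<close>,
  a sink hanging off each spine node \<open>i + 1\<close> by an instantaneous edge of infinite capacity, and for
  each sink an instantaneous edge of tiny capacity from an auxiliary source. If edges may be used in both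
  directions, every sink first relays the small amount from its auxiliary source to the spine and on
  to the next sink, so that each unit crosses one spine edge only, and then uses the same edge to
  receive its own demand. In an orientation the demands exceed what the auxiliary sources can
  deliver, so every sink must be fed from the spine; then no flow enters the spine except at node \<open>0\<close>,
  and what reaches the last sink has crossed all \<open>k\<close> spine edges. Taking node \<open>0\<close> as
  the auxiliary source of all sinks gives a single source, separate leaves give a tree, and time
  reversal turns a single source into a single sink.
\<close>

section \<open>Cumulative flow\<close>

text \<open>For the inflow rate of an arc, the value at \<theta> - \<tau> is the amount that has
  left the arc by \<theta>. A negative argument gives an empty interval and hence 0.\<close>

definition cumulative :: "(real \<Rightarrow> real) \<Rightarrow> real \<Rightarrow> real" where
  "cumulative g \<theta> = (LINT \<xi>:{0..<\<theta>}|lebesgue. g \<xi>)"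

lemma excess_cumulative:
  "excess D f v \<theta> =
     (\<Sum>a\<in>in_arcs (graph D) v. cumulative (f a) (\<theta> - transit D a)) -
     (\<Sum>a\<in>out_arcs (graph D) v. cumulative (f a) \<theta>)"
  by (simp add: excess_def cumulative_def)

lemma cumulative_nonpos [simp]: "\<theta> \<le> 0 \<Longrightarrow> cumulative g \<theta> = 0"
  by (simp add: cumulative_def set_lebesgue_integral_def)

lemma cumulative_cong:
  assumes "\<And>\<xi>. 0 \<le> \<xi> \<Longrightarrow> \<xi> < \<theta> \<Longrightarrow> g \<xi> = h \<xi>"
  shows "cumulative g \<theta> = cumulative h \<theta>"
  unfolding cumulative_def set_lebesgue_integral_def
  by (rule Bochner_Integration.integral_cong) (auto simp: indicator_def assms)

lemma cumulative_split:
  assumes g: "set_integrable lebesgue {0..<\<Theta>} g" and "0 \<le> a" "a \<le> b" "b \<le> \<Theta>"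
  shows "cumulative g b = cumulative g a + (LINT \<xi>:{a..<b}|lebesgue. g \<xi>)"
proof -
  have "{0..<b} = {0..<a} \<union> {a..<b}" "{0..<a} \<inter> {a..<b} = {}"
    using \<open>0 \<le> a\<close> \<open>a \<le> b\<close> by (simp_all add: ivl_disj_un ivl_disj_int)
  moreover have "set_integrable lebesgue {0..<a} g" "set_integrable lebesgue {a..<b} g"
    by (rule set_integrable_subset[OF g]; use \<open>0 \<le> a\<close> \<open>a \<le> b\<close> \<open>b \<le> \<Theta>\<close> in auto)+
  ultimately show ?thesis
    unfolding cumulative_def by (metis set_integral_Un)
qed

lemma cumulative_mono:
  assumes g: "set_integrable lebesgue {0..<\<Theta>} g" and nn: "\<And>\<xi>. \<xi> \<in> {0..<\<Theta>} \<Longrightarrow> 0 \<le> g \<xi>"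
    and "a \<le> b" "b \<le> \<Theta>"
  shows "cumulative g a \<le> cumulative g b"
proof -
  have ge: "0 \<le> (LINT \<xi>:{c..<d}|lebesgue. g \<xi>)" if "0 \<le> c" "d \<le> \<Theta>" for c d
    unfolding set_lebesgue_integral_def
    by (rule Bochner_Integration.integral_nonneg) (use that nn in \<open>auto simp: indicator_def\<close>)
  show ?thesis
  proof (cases "0 \<le> a")
    case True
    then show ?thesis
      using cumulative_split[OF g True \<open>a \<le> b\<close> \<open>b \<le> \<Theta>\<close>] ge[of a b] \<open>b \<le> \<Theta>\<close> by linarith
  next
    case False
    then show ?thesis
      using ge[of 0 b] \<open>b \<le> \<Theta>\<close> by (simp add: cumulative_def[of _ b])
  qed
qed

lemma cumulative_nonneg:
  assumes "set_integrable lebesgue {0..<\<Theta>} g" "\<And>\<xi>. \<xi> \<in> {0..<\<Theta>} \<Longrightarrow> 0 \<le> g \<xi>" "\<theta> \<le> \<Theta>"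
  shows "0 \<le> cumulative g \<theta>"
proof (cases "0 \<le> \<theta>")
  case True
  then show ?thesis
    using cumulative_mono[OF assms(1,2), of 0 \<theta>] assms(3) by simp
qed simp

lemma cumulative_const: "0 \<le> \<theta> \<Longrightarrow> cumulative (\<lambda>_. c) \<theta> = c * \<theta>"
  by (simp add: cumulative_def set_integral_const)

lemma cumulative_le:
  assumes g: "set_integrable lebesgue {0..<\<Theta>} g" and le: "\<And>\<xi>. \<xi> \<in> {0..<\<Theta>} \<Longrightarrow> g \<xi> \<le> c"
    and "0 \<le> \<theta>" "\<theta> \<le> \<Theta>"
  shows "cumulative g \<theta> \<le> c * \<theta>"
proof -
  have "cumulative g \<theta> \<le> cumulative (\<lambda>_. c) \<theta>"
    unfolding cumulative_def
  proof (rule set_integral_mono)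
    show "set_integrable lebesgue {0..<\<theta>} g"
      by (rule set_integrable_subset[OF g]) (use \<open>\<theta> \<le> \<Theta>\<close> in auto)
    show "set_integrable lebesgue {0..<\<theta>} (\<lambda>_. c)"
      unfolding set_integrable_def using \<open>0 \<le> \<theta>\<close> by simp
  qed (use assms in auto)
  then show ?thesis
    using assms by (simp add: cumulative_const)
qed

lemma cumulative_pulse:
  assumes "0 \<le> p"
  shows "cumulative (\<lambda>\<xi>. c * indicator {p..<p + 1} \<xi>) \<theta> = c * max 0 (min 1 (\<theta> - p))"
proof -
  have "cumulative (\<lambda>\<xi>. c * indicator {p..<p + 1} \<xi>) \<theta> =
      (LINT \<xi>|lebesgue. indicator {p..<min \<theta> (p + 1)} \<xi> * c)"
    unfolding cumulative_def set_lebesgue_integral_def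
    by (rule Bochner_Integration.integral_cong) (use assms in \<open>auto simp: indicator_def\<close>)
  also have "\<dots> = measure lebesgue {p..<min \<theta> (p + 1)} * c"
    by (subst integral_mult_left_zero) simp
  also have "measure lebesgue {p..<min \<theta> (p + 1)} = max 0 (min 1 (\<theta> - p))"
    by (cases "p \<le> \<theta>"; cases "\<theta> \<le> p + 1") simp_all
  finally show ?thesis
    by simp
qed

lemma cumulative_reflect:
  assumes g: "set_integrable lebesgue {0..<c} g" and "0 \<le> \<theta>" "\<theta> \<le> c"
  shows "cumulative (\<lambda>\<xi>. g (c - \<xi>)) \<theta> = cumulative g c - cumulative g (c - \<theta>)"
proof -
  have "cumulative (\<lambda>\<xi>. g (c - \<xi>)) \<theta> =
      (LINT \<xi>|lebesgue. indicator {c - \<theta><..c} (c + (-1) * \<xi>) *\<^sub>R g (c + (-1) * \<xi>))"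
    unfolding cumulative_def set_lebesgue_integral_def
    by (rule Bochner_Integration.integral_cong) (auto simp: indicator_def)
  also have "\<dots> = (LINT \<xi>|lebesgue. indicator {c - \<theta><..c} \<xi> *\<^sub>R g \<xi>)"
    using lebesgue_integral_real_affine[of "-1" "\<lambda>x. indicator {c - \<theta><..c} x *\<^sub>R g x" c] by simp
  \<comment> \<open>Reflection leaves the interval half-open at the other end; the two versions
    differ in a null set of endpoints.\<close>
  also have "\<dots> = (LINT \<xi>:{c - \<theta>..<c}|lebesgue. g \<xi>)"
    unfolding set_lebesgue_integral_def[symmetric]
    by (rule set_integral_discrete_difference[where X = "{c - \<theta>, c}"]) (auto)
  finally show ?thesis
    using cumulative_split[OF g, of "c - \<theta>" c] \<open>0 \<le> \<theta>\<close> \<open>\<theta> \<le> c\<close> by linarith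
qed


text \<open>The point \<open>c\<close> may be negative, as for \<Theta> - \<tau> with a transit time
  beyond the horizon.\<close>

lemma cumulative_after:
  assumes "\<And>\<xi>. 0 \<le> \<xi> \<Longrightarrow> c \<le> \<xi> \<Longrightarrow> \<xi> < \<theta> \<Longrightarrow> g \<xi> = 0" and "c \<le> \<theta>"
  shows "cumulative g \<theta> = cumulative g c"
  unfolding cumulative_def set_lebesgue_integral_def
  by (rule Bochner_Integration.integral_cong) (use assms in \<open>auto simp: indicator_def\<close>)

section \<open>Time reversal\<close>

text \<open>
  The value at \<open>0\<close> is set to \<open>0\<close> because the rate at \<open>\<Theta>\<close>, to which it corresponds
  when \<open>\<tau> = 0\<close>, is unconstrained.
\<close>

definition time_reverse :: "real \<Rightarrow> real \<Rightarrow> (real \<Rightarrow> real) \<Rightarrow> real \<Rightarrow> real" where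
  "time_reverse \<Theta> \<tau> g \<theta> = (if 0 < \<theta> \<and> \<theta> < \<Theta> - \<tau> then g (\<Theta> - \<tau> - \<theta>) else 0)"

lemma set_integrable_time_reverse:
  assumes g: "set_integrable lebesgue {0..<\<Theta>} g" and "0 \<le> \<tau>"
  shows "set_integrable lebesgue {0..<\<Theta>} (time_reverse \<Theta> \<tau> g)"
proof -
  \<comment> \<open>Extended by 0, the rate is integrable on the whole line, where the affine
    substitution applies; cutting down to an open interval then yields the reversed rate.\<close>
  let ?h = "\<lambda>x. indicator {0..<\<Theta>} x *\<^sub>R g x"
  have "integrable lebesgue (\<lambda>x. ?h (\<Theta> - \<tau> + (-1) * x))"
    by (rule lebesgue_integrable_real_affine) (use g in \<open>simp_all add: set_integrable_def\<close>)
  then have "integrable lebesgue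
      (\<lambda>x. indicator {0<..<\<Theta> - \<tau>} x *\<^sub>R ?h (\<Theta> - \<tau> + (-1) * x))"
    by (intro integrable_mult_indicator) auto
  also have "(\<lambda>x. indicator {0<..<\<Theta> - \<tau>} x *\<^sub>R ?h (\<Theta> - \<tau> + (-1) * x)) =
      (\<lambda>x. indicator {0..<\<Theta>} x *\<^sub>R time_reverse \<Theta> \<tau> g x)"
    using \<open>0 \<le> \<tau>\<close> by (intro ext) (auto simp: time_reverse_def indicator_def)
  finally show ?thesis
    unfolding set_integrable_def .
qed

text \<open>Flow that enters the original arc at \<xi> leaves it at \<xi> + \<tau>, so it enters the
  reversed arc at \<Theta> - \<tau> - \<xi>. The reversed inflow up to \<theta> is thus the original
  inflow during the last \<theta> time units before \<Theta> - \<tau>.\<close>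

lemma cumulative_time_reverse:
  assumes g: "set_integrable lebesgue {0..<\<Theta>} g" and \<tau>: "0 \<le> \<tau>" and \<theta>: "0 \<le> \<theta>"
  shows "cumulative (time_reverse \<Theta> \<tau> g) \<theta> =
    cumulative g (\<Theta> - \<tau>) - cumulative g (\<Theta> - \<tau> - \<theta>)"
proof -
  let ?c = "\<Theta> - \<tau>"
  \<comment> \<open>Cutting \<open>g\<close> off at \<open>?c\<close> matches the value 0 of
    \<open>time_reverse\<close> at time 0, so that the comparison with the reflection holds
    pointwise.\<close>
  let ?g = "\<lambda>x. if x < ?c then g x else 0"
  have eq: "cumulative ?g x = cumulative g x" if "x \<le> ?c" for x
    by (rule cumulative_cong) (use that in auto)
  have le: "cumulative (time_reverse \<Theta> \<tau> g) x = cumulative g ?c - cumulative g (?c - x)"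
    if x: "0 \<le> x" "x \<le> ?c" for x
  proof -
    have "set_integrable lebesgue {0..<?c} g"
      by (rule set_integrable_subset[OF g]) (use \<tau> in auto)
    then have "set_integrable lebesgue {0..<?c} ?g"
      by (rule set_integrable_cong[THEN iffD1, rotated -1]) auto
    then have "cumulative (\<lambda>\<xi>. ?g (?c - \<xi>)) x = cumulative ?g ?c - cumulative ?g (?c - x)"
      by (rule cumulative_reflect) (use x in auto)
    moreover have "cumulative (time_reverse \<Theta> \<tau> g) x = cumulative (\<lambda>\<xi>. ?g (?c - \<xi>)) x"
      by (rule cumulative_cong) (use x in \<open>auto simp: time_reverse_def\<close>)
    ultimately show ?thesis
      using eq[of ?c] eq[of "?c - x"] x by simp
  qed
  show ?thesis
  proof (cases "\<theta> \<le> ?c")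
    case True
    then show ?thesis
      using le \<theta> by simp
  next
    case False
    then have "cumulative (time_reverse \<Theta> \<tau> g) \<theta> = cumulative (time_reverse \<Theta> \<tau> g) ?c"
      by (intro cumulative_after) (auto simp: time_reverse_def)
    then show ?thesis
      using le[of ?c] False by (cases "0 \<le> ?c") simp_all
  qed
qed

text \<open>Counterpart for the flow leaving the reversed arc by \<theta>, which is the original
  inflow from \<Theta> - \<theta> on. While \<theta> < \<tau>, both sides are 0 because
  \<open>late\<close> lets nothing enter after \<Theta> - \<tau>.\<close>

lemma cumulative_time_reverse_shifted:
  assumes g: "set_integrable lebesgue {0..<\<Theta>} g" and \<tau>: "0 \<le> \<tau>" and \<theta>: "0 \<le> \<theta>"
    and late: "\<And>\<xi>. \<xi> \<in> {0..<\<Theta>} \<Longrightarrow> \<Theta> - \<tau> \<le> \<xi> \<Longrightarrow> g \<xi> = 0"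
  shows "cumulative (time_reverse \<Theta> \<tau> g) (\<theta> - \<tau>) = cumulative g \<Theta> - cumulative g (\<Theta> - \<theta>)"
proof -
  have after: "cumulative g x = cumulative g (\<Theta> - \<tau>)" if "\<Theta> - \<tau> \<le> x" "x \<le> \<Theta>" for x
    by (rule cumulative_after) (use that late in auto)
  show ?thesis
  proof (cases "\<tau> \<le> \<theta>")
    case True
    have "cumulative (time_reverse \<Theta> \<tau> g) (\<theta> - \<tau>) =
        cumulative g (\<Theta> - \<tau>) - cumulative g (\<Theta> - \<tau> - (\<theta> - \<tau>))"
      by (rule cumulative_time_reverse[OF g \<tau>]) (use True in simp)
    moreover have "cumulative g \<Theta> = cumulative g (\<Theta> - \<tau>)"
      by (rule after) (use \<tau> in simp_all)
    ultimately show ?thesis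
      by simp
  next
    case False
    have "cumulative g \<Theta> = cumulative g (\<Theta> - \<tau>)" "cumulative g (\<Theta> - \<theta>) = cumulative g (\<Theta> - \<tau>)"
      by (rule after; use \<tau> \<theta> False in simp)+
    then show ?thesis
      using False by simp
  qed
qed

section \<open>Saturation and reversal of flows in directed networks\<close>

definition wf_network :: "('v, 'a) directed_network \<Rightarrow> bool" where
  "wf_network D \<longleftrightarrow>
     finite (verts (graph D)) \<and> finite (arcs (graph D)) \<and>
     (\<forall>a\<in>arcs (graph D). tail (graph D) a \<in> verts (graph D) \<and>
        head (graph D) a \<in> verts (graph D) \<and> 0 \<le> transit D a) \<and>
     (\<Sum>v\<in>verts (graph D). balance D v) = 0"

definition supply_of :: "('v, 'a) directed_network \<Rightarrow> real" where
  "supply_of D = (\<Sum>v\<in>{v \<in> verts (graph D). 0 < balance D v}. balance D v)"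

text \<open>Every arc is counted once at its head and once at its tail, and all that entered it has
  left by \<Theta>.\<close>

lemma sum_excess_eq_0:
  assumes D: "wf_network D" and f: "flow_over_time D \<Theta> f"
  shows "(\<Sum>v\<in>verts (graph D). excess D f v \<Theta>) = 0"
proof -
  have "(\<Sum>v\<in>verts (graph D). \<Sum>a\<in>in_arcs (graph D) v. cumulative (f a) (\<Theta> - transit D a)) =
      (\<Sum>a\<in>arcs (graph D). cumulative (f a) (\<Theta> - transit D a))"
    unfolding in_arcs_def using D by (intro sum.group) (auto simp: wf_network_def)
  moreover have "(\<Sum>v\<in>verts (graph D). \<Sum>a\<in>out_arcs (graph D) v. cumulative (f a) \<Theta>) =
      (\<Sum>a\<in>arcs (graph D). cumulative (f a) \<Theta>)"
    unfolding out_arcs_def using D by (intro sum.group) (auto simp: wf_network_def)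
  moreover have "cumulative (f a) \<Theta> = cumulative (f a) (\<Theta> - transit D a)"
    if "a \<in> arcs (graph D)" for a
    by (rule cumulative_after) (use that D f in \<open>auto simp: wf_network_def flow_over_time_def\<close>)
  ultimately show ?thesis
    by (simp add: excess_cumulative sum_subtractf)
qed

text \<open>The slack \<open>q\<close> is nonnegative at sources, nonpositive at sinks and zero
  elsewhere. Its total is 0, and its sum over the sinks is 0 because the value equals the supply; so
  both one-signed sums vanish termwise.\<close>

lemma excess_saturated:
  assumes D: "wf_network D" and f: "flow_over_time D \<Theta> f" "flow_value D \<Theta> f = supply_of D"
    and v: "v \<in> verts (graph D)"
  shows "excess D f v \<Theta> = - balance D v"
proof -
  let ?V = "verts (graph D)"
  let ?P = "{v \<in> ?V. 0 < balance D v}" and ?M = "{v \<in> ?V. balance D v < 0}"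
    and ?Z = "{v \<in> ?V. balance D v = 0}"
  define q where "q = (\<lambda>v. excess D f v \<Theta> + balance D v)"
  have fin: "finite ?V" and b0: "sum (balance D) ?V = 0"
    using D by (auto simp: wf_network_def)
  have \<Theta>: "\<Theta> \<in> {0..\<Theta>}"
    using f by (auto simp: flow_over_time_def)
  have nonneg: "0 \<le> q v" if "v \<in> ?P" for v
    using f \<Theta> that unfolding q_def flow_over_time_def by fastforce
  have nonpos: "q v \<le> 0" if "v \<in> ?M" for v
    using f \<Theta> that unfolding q_def flow_over_time_def by fastforce
  have zero: "q v = 0" if "v \<in> ?Z" for v
    using f that unfolding q_def flow_over_time_def by fastforce
  have split: "sum h ?V = sum h ?P + sum h ?M + sum h ?Z" for h :: "_ \<Rightarrow> real"
  proof -
    have "sum h (?P \<union> ?M \<union> ?Z) = sum h ?P + sum h ?M + sum h ?Z"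
      using fin by (subst sum.union_disjoint; (subst sum.union_disjoint)?) auto
    moreover have "?V = ?P \<union> ?M \<union> ?Z"
      by auto
    ultimately show ?thesis
      by metis
  qed
  have "sum q ?V = 0"
    unfolding q_def sum.distrib using sum_excess_eq_0[OF D f(1)] b0 by simp
  moreover have "sum (balance D) ?Z = 0" "sum q ?Z = 0"
    using zero by (auto intro: sum.neutral)
  moreover have "sum q ?M = supply_of D + sum (balance D) ?M"
    unfolding q_def sum.distrib using f(2) by (simp add: flow_value_def)
  ultimately have "sum q ?M = 0" "sum q ?P = 0"
    using split[of q] split[of "balance D"] b0 by (auto simp: supply_of_def)
  then have "\<forall>v\<in>?M. q v = 0" "\<forall>v\<in>?P. q v = 0"
    using sum_nonneg_eq_0_iff[of ?P q] sum_nonneg_eq_0_iff[of ?M "\<lambda>v. - q v"] nonneg nonpos fin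
    by (auto simp: sum_negf)
  then have "q v = 0"
    using zero v by (cases "balance D v" "0 :: real" rule: linorder_cases) auto
  then show ?thesis
    by (simp add: q_def)
qed

text \<open>The renaming \<rho> serves two uses: an orientation keeps its arc names when reversed,
  whereas in a bidirected network the reverse of \<open>(e, v, w)\<close> is the arc
  \<open>(e, w, v)\<close>.\<close>

definition is_reversal ::
    "('b \<Rightarrow> 'a) \<Rightarrow> ('v, 'a) directed_network \<Rightarrow> ('v, 'b) directed_network \<Rightarrow> bool" where
  "is_reversal \<rho> D D' \<longleftrightarrow>
     verts (graph D') = verts (graph D) \<and>
     bij_betw \<rho> (arcs (graph D')) (arcs (graph D)) \<and>
     (\<forall>a\<in>arcs (graph D').
        tail (graph D') a = head (graph D) (\<rho> a) \<and> head (graph D') a = tail (graph D) (\<rho> a) \<and>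
        capacity D' a = capacity D (\<rho> a) \<and> transit D' a = transit D (\<rho> a)) \<and>
     (\<forall>v. balance D' v = - balance D v)"

definition reverse_flow ::
    "('b \<Rightarrow> 'a) \<Rightarrow> ('v, 'a) directed_network \<Rightarrow> real \<Rightarrow> ('a \<Rightarrow> real \<Rightarrow> real) \<Rightarrow> 'b \<Rightarrow> real \<Rightarrow> real" where
  "reverse_flow \<rho> D \<Theta> f a = time_reverse \<Theta> (transit D (\<rho> a)) (f (\<rho> a))"

text \<open>In-arcs and out-arcs of \<open>v\<close> trade places, so the bookkeeping at
  \<open>v\<close> runs backwards from its final state.\<close>

lemma excess_reverse_flow:
  assumes D: "wf_network D" and r: "is_reversal \<rho> D D'" and f: "flow_over_time D \<Theta> f"
    and \<theta>: "0 \<le> \<theta>" "\<theta> \<le> \<Theta>"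
  shows "excess D' (reverse_flow \<rho> D \<Theta> f) v \<theta> = excess D f v (\<Theta> - \<theta>) - excess D f v \<Theta>"
proof -
  have arcs: "\<rho> a \<in> arcs (graph D)" if "a \<in> arcs (graph D')" for a
    using r that by (auto simp: is_reversal_def bij_betw_def)
  have inj: "inj_on \<rho> (arcs (graph D'))" and img: "arcs (graph D) = \<rho> ` arcs (graph D')"
    using r by (auto simp: is_reversal_def bij_betw_def)
  have "\<rho> ` in_arcs (graph D') v = out_arcs (graph D) v"
    and "\<rho> ` out_arcs (graph D') v = in_arcs (graph D) v"
    using r by (auto simp: is_reversal_def in_arcs_def out_arcs_def img)
  then have "bij_betw \<rho> (in_arcs (graph D') v) (out_arcs (graph D) v)"
    and "bij_betw \<rho> (out_arcs (graph D') v) (in_arcs (graph D) v)"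
    by (auto simp: bij_betw_def in_arcs_def out_arcs_def intro: inj_on_subset[OF inj])
  note bij = this[THEN sum.reindex_bij_betw]
  have "(\<Sum>a\<in>in_arcs (graph D') v.
      cumulative (reverse_flow \<rho> D \<Theta> f a) (\<theta> - transit D' a)) =
    (\<Sum>a\<in>in_arcs (graph D') v. cumulative (f (\<rho> a)) \<Theta> - cumulative (f (\<rho> a)) (\<Theta> - \<theta>))"
  proof (rule sum.cong)
    fix a assume "a \<in> in_arcs (graph D') v"
    then have a: "\<rho> a \<in> arcs (graph D)" "transit D' a = transit D (\<rho> a)"
      using arcs r by (auto simp: is_reversal_def in_arcs_def)
    show "cumulative (reverse_flow \<rho> D \<Theta> f a) (\<theta> - transit D' a) =
        cumulative (f (\<rho> a)) \<Theta> - cumulative (f (\<rho> a)) (\<Theta> - \<theta>)"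
      unfolding reverse_flow_def a(2)
      by (rule cumulative_time_reverse_shifted)
        (use a f D \<theta> in \<open>auto simp: flow_over_time_def wf_network_def\<close>)
  qed simp
  moreover have "(\<Sum>a\<in>out_arcs (graph D') v. cumulative (reverse_flow \<rho> D \<Theta> f a) \<theta>) =
    (\<Sum>a\<in>out_arcs (graph D') v. cumulative (f (\<rho> a)) (\<Theta> - transit D (\<rho> a)) -
       cumulative (f (\<rho> a)) (\<Theta> - \<theta> - transit D (\<rho> a)))"
  proof (rule sum.cong)
    fix a assume "a \<in> out_arcs (graph D') v"
    then have a: "\<rho> a \<in> arcs (graph D)"
      using arcs by (auto simp: out_arcs_def)
    have "cumulative (reverse_flow \<rho> D \<Theta> f a) \<theta> =
        cumulative (f (\<rho> a)) (\<Theta> - transit D (\<rho> a)) -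
        cumulative (f (\<rho> a)) (\<Theta> - transit D (\<rho> a) - \<theta>)"
      unfolding reverse_flow_def
      by (rule cumulative_time_reverse)
        (use a f D \<theta> in \<open>auto simp: flow_over_time_def wf_network_def\<close>)
    then show "cumulative (reverse_flow \<rho> D \<Theta> f a) \<theta> =
        cumulative (f (\<rho> a)) (\<Theta> - transit D (\<rho> a)) -
        cumulative (f (\<rho> a)) (\<Theta> - \<theta> - transit D (\<rho> a))"
      by (simp add: algebra_simps)
  qed simp
  ultimately show ?thesis
    unfolding excess_cumulative
    by (simp add: sum_subtractf bij(1)[of "\<lambda>a. cumulative (f a) \<Theta>"]
        bij(1)[of "\<lambda>a. cumulative (f a) (\<Theta> - \<theta>)"]
        bij(2)[of "\<lambda>a. cumulative (f a) (\<Theta> - transit D a)"]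
        bij(2)[of "\<lambda>a. cumulative (f a) (\<Theta> - \<theta> - transit D a)"])
qed

text \<open>By saturation the final excess is minus the balance, so the reversed excess is the old
  one at \<Theta> - \<theta> plus the balance. This turns the bounds for a source into those for a
  sink and vice versa.\<close>

lemma flow_over_time_reverse_flow:
  assumes D: "wf_network D" and r: "is_reversal \<rho> D D'"
    and f: "flow_over_time D \<Theta> f" "flow_value D \<Theta> f = supply_of D"
  shows "flow_over_time D' \<Theta> (reverse_flow \<rho> D \<Theta> f)"
    and "flow_value D' \<Theta> (reverse_flow \<rho> D \<Theta> f) = supply_of D"
proof -
  note ex = excess_reverse_flow[OF D r f(1)] and sat = excess_saturated[OF D f]
  have \<Theta>: "0 \<le> \<Theta>"
    using f by (auto simp: flow_over_time_def)
  have ex0: "excess D f v 0 = 0" for v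
    unfolding excess_cumulative using D
    by (auto simp: wf_network_def in_arcs_def intro!: sum.neutral)
  have V: "verts (graph D') = verts (graph D)" and bal: "balance D' v = - balance D v" for v
    using r by (auto simp: is_reversal_def)
  have "set_integrable lebesgue {0..<\<Theta>} (reverse_flow \<rho> D \<Theta> f a) \<and>
      (\<forall>\<theta>\<in>{0..<\<Theta>}. 0 \<le> reverse_flow \<rho> D \<Theta> f a \<theta> \<and>
         ereal (reverse_flow \<rho> D \<Theta> f a \<theta>) \<le> capacity D' a \<and>
         (\<Theta> - transit D' a \<le> \<theta> \<longrightarrow> reverse_flow \<rho> D \<Theta> f a \<theta> = 0))"
    if "a \<in> arcs (graph D')" for a
  proof -
    have a: "\<rho> a \<in> arcs (graph D)" "transit D' a = transit D (\<rho> a)"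
        "capacity D' a = capacity D (\<rho> a)"
      using r that by (auto simp: is_reversal_def bij_betw_def)
    then have g: "set_integrable lebesgue {0..<\<Theta>} (f (\<rho> a))" "0 \<le> transit D (\<rho> a)"
      and rate: "\<forall>\<theta>\<in>{0..<\<Theta>}. 0 \<le> f (\<rho> a) \<theta> \<and> ereal (f (\<rho> a) \<theta>) \<le> capacity D' a"
      using f D by (auto simp: flow_over_time_def wf_network_def)
    \<comment> \<open>The reversed rate is 0 at some times; that this respects the capacity follows
      from the existence of a nonnegative feasible rate.\<close>
    have "0 \<le> capacity D' a" if "0 < \<Theta>"
      using bspec[OF rate, of 0] that by (auto intro: order_trans[of 0 "ereal (f (\<rho> a) 0)"])
    then show ?thesis
      using set_integrable_time_reverse[OF g] rate g(2) a(2)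
      by (auto simp: reverse_flow_def time_reverse_def zero_ereal_def[symmetric])
  qed
  moreover have "(balance D' v = 0 \<longrightarrow>
       (\<forall>\<theta>\<in>{0..\<Theta>}. 0 \<le> excess D' (reverse_flow \<rho> D \<Theta> f) v \<theta>) \<and>
       excess D' (reverse_flow \<rho> D \<Theta> f) v \<Theta> = 0) \<and>
     (0 < balance D' v \<longrightarrow>
       (\<forall>\<theta>\<in>{0..\<Theta>}. 0 \<le> - excess D' (reverse_flow \<rho> D \<Theta> f) v \<theta> \<and>
          - excess D' (reverse_flow \<rho> D \<Theta> f) v \<theta> \<le> balance D' v)) \<and>
     (balance D' v < 0 \<longrightarrow>
       (\<forall>\<theta>\<in>{0..\<Theta>}. 0 \<le> excess D' (reverse_flow \<rho> D \<Theta> f) v \<theta> \<and>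
          excess D' (reverse_flow \<rho> D \<Theta> f) v \<theta> \<le> - balance D' v))"
    if "v \<in> verts (graph D)" for v
  proof -
    have "\<Theta> - \<theta> \<in> {0..\<Theta>}" if "\<theta> \<in> {0..\<Theta>}" for \<theta>
      using that by auto
    then have f': "balance D v = 0 \<longrightarrow> (\<forall>\<theta>\<in>{0..\<Theta>}. 0 \<le> excess D f v (\<Theta> - \<theta>))"
      "0 < balance D v \<longrightarrow> (\<forall>\<theta>\<in>{0..\<Theta>}.
         0 \<le> - excess D f v (\<Theta> - \<theta>) \<and> - excess D f v (\<Theta> - \<theta>) \<le> balance D v)"
      "balance D v < 0 \<longrightarrow> (\<forall>\<theta>\<in>{0..\<Theta>}.
         0 \<le> excess D f v (\<Theta> - \<theta>) \<and> excess D f v (\<Theta> - \<theta>) \<le> - balance D v)"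
      using f(1) that unfolding flow_over_time_def by blast+
    then show ?thesis
      using \<Theta> sat[OF that] by (force simp: ex ex0 bal)
  qed
  ultimately show "flow_over_time D' \<Theta> (reverse_flow \<rho> D \<Theta> f)"
    unfolding flow_over_time_def V using \<Theta> by blast
  show "flow_value D' \<Theta> (reverse_flow \<rho> D \<Theta> f) = supply_of D"
    unfolding flow_value_def supply_of_def V bal
    using \<Theta> by (intro sum.cong) (auto simp: ex ex0 sat)
qed


section \<open>Bidirected networks and trees\<close>

text \<open>Fixing an order \<open>A e\<close>, \<open>B e\<close> of the ends turns sums over arcs
  into sums over edges. As the ends differ, at most one of the two summands belongs to an arc into
  \<open>v\<close>.\<close>

lemma sum_in_arcs_bidirected:
  assumes "finite (edges (graph N))"
    and ends: "\<And>e. e \<in> edges (graph N) \<Longrightarrow> ends (graph N) e = {A e, B e} \<and> A e \<noteq> B e"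
  shows "(\<Sum>a\<in>in_arcs (graph (bidirected N)) v. h a) =
    (\<Sum>e\<in>edges (graph N). (if B e = v then h (e, A e, v) else 0) + (if A e = v then h (e, B e, v) else 0))"
proof -
  let ?other = "\<lambda>e. if B e = v then A e else B e"
  have "in_arcs (graph (bidirected N)) v =
      (\<lambda>e. (e, ?other e, v)) ` {e \<in> edges (graph N). A e = v \<or> B e = v}"
    using ends by (auto simp: in_arcs_def bidirected_def image_iff doubleton_eq_iff)
  then have "(\<Sum>a\<in>in_arcs (graph (bidirected N)) v. h a) =
      (\<Sum>e\<in>{e \<in> edges (graph N). A e = v \<or> B e = v}. h (e, ?other e, v))"
    by (simp add: sum.reindex inj_on_def)
  also have "\<dots> = (\<Sum>e\<in>edges (graph N). if A e = v \<or> B e = v then h (e, ?other e, v) else 0)"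
    using assms(1) by (rule sum.inter_filter)
  also have "\<dots> = (\<Sum>e\<in>edges (graph N).
      (if B e = v then h (e, A e, v) else 0) + (if A e = v then h (e, B e, v) else 0))"
    using ends by (intro sum.cong) auto
  finally show ?thesis .
qed

lemma sum_out_arcs_bidirected:
  assumes "finite (edges (graph N))"
    and ends: "\<And>e. e \<in> edges (graph N) \<Longrightarrow> ends (graph N) e = {A e, B e} \<and> A e \<noteq> B e"
  shows "(\<Sum>a\<in>out_arcs (graph (bidirected N)) v. h a) =
    (\<Sum>e\<in>edges (graph N). (if A e = v then h (e, v, B e) else 0) + (if B e = v then h (e, v, A e) else 0))"
proof -
  let ?swap = "\<lambda>(e, v, w). (e, w, v)"
  have "out_arcs (graph (bidirected N)) v = ?swap ` in_arcs (graph (bidirected N)) v"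
    by (auto simp: in_arcs_def out_arcs_def bidirected_def image_iff insert_commute)
  moreover have "inj_on ?swap (in_arcs (graph (bidirected N)) v)"
    by (auto simp: inj_on_def)
  ultimately have "(\<Sum>a\<in>out_arcs (graph (bidirected N)) v. h a) =
      (\<Sum>a\<in>in_arcs (graph (bidirected N)) v. h (?swap a))"
    by (simp add: sum.reindex)
  also have "\<dots> = (\<Sum>e\<in>edges (graph N).
      (if A e = v then h (e, v, B e) else 0) + (if B e = v then h (e, v, A e) else 0))"
    using assms by (simp add: sum_in_arcs_bidirected[where A = A and B = B] add.commute cong: if_cong)
  finally show ?thesis .
qed

lemma wf_network_bidirected:
  assumes "is_undirected_network N"
  shows "wf_network (bidirected N)"
proof -
  have N: "finite (nodes (graph N))" "finite (edges (graph N))"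
      "\<And>e. e \<in> edges (graph N) \<Longrightarrow> ends (graph N) e \<subseteq> nodes (graph N)"
    using assms by (auto simp: is_undirected_network_def finite_multigraph_def)
  have "arcs (graph (bidirected N)) \<subseteq> edges (graph N) \<times> nodes (graph N) \<times> nodes (graph N)"
    using N(3) by (auto simp: bidirected_def)
  then have "finite (arcs (graph (bidirected N)))"
    using N by (meson finite_SigmaI finite_subset)
  then show ?thesis
    using assms N unfolding wf_network_def
    by (auto simp: bidirected_def is_undirected_network_def)
qed

lemma wf_network_orientation:
  assumes N: "is_undirected_network N" and D: "is_orientation N D"
  shows "wf_network D"
proof -
  have "tail (graph D) a \<in> nodes (graph N)" "head (graph D) a \<in> nodes (graph N)"
    if "a \<in> edges (graph N)" for a
    using N D that unfolding is_undirected_network_def finite_multigraph_def is_orientation_def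
    by blast+
  then show ?thesis
    using assms by (simp add: wf_network_def is_undirected_network_def finite_multigraph_def
        is_orientation_def)
qed

lemma supply_of_bidirected: "supply_of (bidirected N) = total_supply N"
  by (simp add: supply_of_def total_supply_def sources_def bidirected_def)

lemma supply_of_orientation: "is_orientation N D \<Longrightarrow> supply_of D = total_supply N"
  by (simp add: supply_of_def total_supply_def sources_def is_orientation_def)

section \<open>Exchanging sources and sinks\<close>

definition negate :: "('v, 'e) undirected_network \<Rightarrow> ('v, 'e) undirected_network" where
  "negate N = N\<lparr>balance := \<lambda>v. - balance N v\<rparr>"

lemma negate_simps [simp]:
  "graph (negate N) = graph N" "capacity (negate N) = capacity N"
  "transit (negate N) = transit N" "balance (negate N) v = - balance N v"
  by (simp_all add: negate_def)

lemma is_undirected_network_negate: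
  "is_undirected_network N \<Longrightarrow> is_undirected_network (negate N)"
  by (simp add: is_undirected_network_def sum_negf)

lemma sinks_negate: "sinks (negate N) = sources N"
  by (simp add: sinks_def sources_def)

lemma total_supply_negate:
  assumes "is_undirected_network N"
  shows "total_supply (negate N) = total_supply N"
proof -
  have fin: "finite (nodes (graph N))" and b: "sum (balance N) (nodes (graph N)) = 0"
    using assms by (auto simp: is_undirected_network_def finite_multigraph_def)
  have "sum (balance N) (nodes (graph N)) = sum (balance N) (sources N \<union> sinks N)"
    by (rule sum.mono_neutral_right) (use fin in \<open>auto simp: sources_def sinks_def\<close>)
  also have "\<dots> = sum (balance N) (sources N) + sum (balance N) (sinks N)"
    by (rule sum.union_disjoint) (use fin in \<open>auto simp: sources_def sinks_def\<close>)
  finally show ?thesis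
    using b by (simp add: total_supply_def sources_def sinks_def sum_negf)
qed

lemma undirected_can_send_negate:
  assumes N: "is_undirected_network N" and send: "undirected_can_send N (total_supply N) \<Theta>"
  shows "undirected_can_send (negate N) (total_supply (negate N)) \<Theta>"
proof -
  let ?swap = "\<lambda>(e, v, w). (e, w, v)"
  obtain f where f: "undirected_flow_over_time N \<Theta> f"
    and val: "flow_value (bidirected N) \<Theta> f = total_supply N"
    using send by (auto simp: undirected_can_send_def)
  have r: "is_reversal ?swap (bidirected N) (bidirected (negate N))"
    unfolding is_reversal_def bij_betw_def inj_on_def
    by (auto simp: bidirected_def image_iff insert_commute)
  have fl: "flow_over_time (bidirected N) \<Theta> f"
    using f by (simp add: undirected_flow_over_time_def)
  define g where "g = reverse_flow ?swap (bidirected N) \<Theta> f"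
  note fg = flow_over_time_reverse_flow[OF wf_network_bidirected[OF N] r fl,
      unfolded supply_of_bidirected, OF val, folded g_def]
  \<comment> \<open>Both directions of an edge share one transit time, so their reversed rates stem
    from the same original moment and inherit the joint bound.\<close>
  have "ereal (g (e, v, w) \<theta> + g (e, w, v) \<theta>) \<le> capacity N e"
    if e: "e \<in> edges (graph N)" "ends (graph N) e = {v, w}" and \<theta>: "\<theta> \<in> {0..<\<Theta>}" for e v w \<theta>
  proof -
    let ?c = "\<Theta> - transit N e"
    have "transit N e \<ge> 0" "capacity N e \<ge> 0"
      using N e by (auto simp: is_undirected_network_def)
    moreover have "ereal (f (e, w, v) (?c - \<theta>) + f (e, v, w) (?c - \<theta>)) \<le> capacity N e"
      if "0 < \<theta>" "\<theta> < ?c"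
      using f e that \<open>transit N e \<ge> 0\<close>
      unfolding undirected_flow_over_time_def by (auto simp: insert_commute)
    ultimately show ?thesis
      by (auto simp: g_def reverse_flow_def time_reverse_def bidirected_def
          zero_ereal_def[symmetric])
  qed
  then have "undirected_flow_over_time (negate N) \<Theta> g"
    using fg(1) by (simp add: undirected_flow_over_time_def)
  then show ?thesis
    using fg(2) total_supply_negate[OF N] unfolding undirected_can_send_def by auto
qed

text \<open>Transfers lower bounds on the horizon from \<open>N\<close> to \<open>negate N\<close>:
  a fast orientation of the latter, with all arcs turned round, is a fast orientation of
  \<open>N\<close>.\<close>

lemma can_send_orientation_negate:
  assumes N: "is_undirected_network N" and D: "is_orientation (negate N) D"
    and send: "can_send D (total_supply (negate N)) \<Theta>"
  obtains D' where "is_orientation N D'" "can_send D' (total_supply N) \<Theta>"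
proof
  let ?D = "D\<lparr>graph := (graph D)\<lparr>tail := head (graph D), head := tail (graph D)\<rparr>,
    balance := \<lambda>v. - balance D v\<rparr>"
  show "is_orientation N ?D"
    using D by (auto simp: is_orientation_def insert_commute)
  have r: "is_reversal id D ?D"
    by (simp add: is_reversal_def)
  obtain f where "flow_over_time D \<Theta> f" "flow_value D \<Theta> f = supply_of D"
    using send supply_of_orientation[OF D] by (auto simp: can_send_def)
  from flow_over_time_reverse_flow[OF
      wf_network_orientation[OF is_undirected_network_negate[OF N] D] r this]
  show "can_send ?D (total_supply N) \<Theta>"
    unfolding can_send_def
    using supply_of_orientation[OF D] total_supply_negate[OF N] by auto
qed

text \<open>Following parents leads every node to 0. On a cycle, the largest node would have two
  cycle edges, but only the edge to its parent leads to a node that is not larger.\<close>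

lemma is_tree_parent:
  assumes nodes: "nodes G = {..<Suc m}" and edges: "edges G = {..<m}"
    and parent: "\<And>e. e < m \<Longrightarrow> p e \<le> e"
    and ends: "\<And>e. e < m \<Longrightarrow> ends G e = {p e, Suc e}"
  shows "is_tree G"
proof -
  let ?R = "{(x, y). \<exists>e\<in>edges G. ends G e = {x, y}}"
  have root: "(0, v) \<in> ?R\<^sup>*" if "v < Suc m" for v
    using that
  proof (induction v rule: less_induct)
    case (less v)
    show ?case
    proof (cases v)
      case (Suc e)
      then have e: "e < m"
        using less.prems by simp
      then have "(0, p e) \<in> ?R\<^sup>*"
        using less.IH[of "p e"] parent[OF e] Suc by simp
      moreover have "(p e, v) \<in> ?R"
        using e ends Suc edges by auto
      ultimately show ?thesis
        by (rule rtrancl_into_rtrancl)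
    qed simp
  qed
  have "sym ?R"
    by (auto simp: sym_def insert_commute)
  then have "(v, w) \<in> ?R\<^sup>*" if "v < Suc m" "w < Suc m" for v w
    using root[OF that(1)] root[OF that(2)] sym_rtrancl[of ?R]
    by (meson rtrancl_trans symD)
  then have "connected_multigraph G"
    unfolding connected_multigraph_def nodes by auto
  moreover have False if cyc: "is_cycle G vs es" for vs es
  proof -
    let ?L = "length vs"
    note c = cyc[unfolded is_cycle_def]
    have "Max (set vs) \<in> set vs"
      using c by (intro Max_in) auto
    then obtain j where j: "j < ?L" "vs ! j = Max (set vs)"
      by (auto simp: in_set_conv_nth)
    have edge: "es ! i < m" "ends G (es ! i) = {vs ! i, vs ! (Suc i mod ?L)}" if "i < ?L" for i
      using c that edges by (auto simp: subset_iff)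
    have mem: "vs ! i \<in> set vs" "vs ! (Suc i mod ?L) \<in> set vs" if "i < ?L" for i
      using that by (auto intro!: nth_mem mod_less_divisor)
    \<comment> \<open>An edge at the largest node of the cycle must have it as its upper end
      \<open>Suc e\<close>, which determines the edge.\<close>
    have top: "Suc (es ! i) = Max (set vs)" if "i < ?L" "Max (set vs) \<in> ends G (es ! i)" for i
    proof -
      have e: "ends G (es ! i) = {p (es ! i), Suc (es ! i)}" "p (es ! i) \<le> es ! i"
        using edge(1)[OF that(1)] ends parent by auto
      then have "Suc (es ! i) \<in> {vs ! i, vs ! (Suc i mod ?L)}"
        unfolding edge(2)[OF that(1), symmetric] by simp
      then have "Suc (es ! i) \<in> set vs"
        using mem[OF that(1)] by (metis insertE singletonD)
      then have "Suc (es ! i) \<le> Max (set vs)"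
        by simp
      then show ?thesis
        using e that(2) by auto
    qed
    define j' where "j' = (if j = 0 then ?L - 1 else j - 1)"
    have j': "j' < ?L" "Suc j' mod ?L = j"
      using j by (auto simp: j'_def)
    have "es ! j = es ! j'"
      using top[OF j(1)] top[OF j'(1)] edge[OF j(1)] edge[OF j'(1)] j j' by auto
    \<comment> \<open>Distinct edges leave only a cycle of length 1, which would be a loop.\<close>
    then have "j = j'"
      using c j j' nth_eq_iff_index_eq by metis
    then have "{p (es ! j), Suc (es ! j)} = {vs ! j}"
      using edge[OF j(1)] ends j' by auto
    then have "p (es ! j) = Suc (es ! j)"
      by (simp add: singleton_insert_inj_eq')
    then show False
      using parent[OF edge(1)[OF j(1)]] by simp
  qed
  ultimately show ?thesis
    by (auto simp: is_tree_def)
qed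

section \<open>The comb network\<close>

text \<open>The spine occupies the nodes up to \<open>k\<close> and the sinks those from
  \<open>k + 1\<close> to \<open>2 * k\<close>. The parameter \<open>z\<close> may place auxiliary
  sources at node 0 or beyond \<open>2 * k\<close>, possibly several at one node.\<close>

locale comb =
  fixes k n :: nat and T :: real and z :: "nat \<Rightarrow> nat"
  assumes k: "0 < k" and T: "0 < T" and n: "2 * k < n"
    and z: "\<And>i. i < k \<Longrightarrow> z i = 0 \<or> 2 * k < z i" "\<And>i. i < k \<Longrightarrow> z i < n"
begin

text \<open>
  Edge \<open>i < k\<close> joins the spine nodes \<open>i\<close> and \<open>i + 1\<close>, edge \<open>k + i\<close> joins \<open>i + 1\<close> to the sink
  \<open>k + 1 + i\<close>, and edge \<open>2 * k + i\<close> joins this sink to its auxiliary source \<open>z i\<close>, which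
  supplies \<open>demand (i + 1)\<close>. Since \<open>demand k = 0\<close>, the last sink has nothing to relay.
\<close>

definition demand :: "nat \<Rightarrow> real" where
  "demand i = (if i < k then (real k * T + 1) ^ (k - i) else 0)"

definition left :: "nat \<Rightarrow> nat" where
  "left e = (if e < k then e else e - k + 1)"

definition right :: "nat \<Rightarrow> nat" where
  "right e = (if e < 2 * k then e + 1 else z (e - 2 * k))"

text \<open>The extra \<open>demand 0\<close> at node 0 is meant for the first sink, for which no
  other sink relays.\<close>

definition supply_at :: "nat \<Rightarrow> real" where
  "supply_at v = (if v = 0 then demand 0 else 0) + (\<Sum>i<k. if z i = v then demand (Suc i) else 0)"

definition demand_at :: "nat \<Rightarrow> real" where
  "demand_at v = (\<Sum>i<k. if k + 1 + i = v then demand i else 0)"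

definition net :: "(nat, nat) undirected_network" where
  "net = \<lparr>graph = \<lparr>nodes = {..<n}, edges = {..<3 * k}, ends = (\<lambda>e. {left e, right e})\<rparr>,
          capacity = (\<lambda>e. if e < 2 * k then \<infinity> else ereal (demand (e - 2 * k + 1))),
          balance = (\<lambda>v. supply_at v - demand_at v),
          transit = (\<lambda>e. if e < k then T else 0)\<rparr>"

lemma net_simps [simp]:
  "nodes (graph net) = {..<n}" "edges (graph net) = {..<3 * k}"
  "ends (graph net) e = {left e, right e}"
  "capacity net e = (if e < 2 * k then \<infinity> else ereal (demand (e - 2 * k + 1)))"
  "balance net v = supply_at v - demand_at v"
  "transit net e = (if e < k then T else 0)"
  by (simp_all add: net_def)

lemma demand_pos: "i < k \<Longrightarrow> 0 < demand i"
  using T by (simp add: demand_def add_nonneg_pos)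

lemma demand_nonneg [simp]: "0 \<le> demand i"
  using demand_pos[of i] by (cases "i < k") (auto simp: demand_def)

lemma demand_k [simp]: "demand k = 0"
  by (simp add: demand_def)

text \<open>Demands fall by the factor \<open>k * T + 1\<close>, which exceeds every horizon below
  \<open>k * T\<close>. Hence an auxiliary edge of capacity \<open>demand (Suc i)\<close> cannot
  satisfy sink number \<open>i\<close> in time.\<close>

lemma demand_Suc:
  assumes "i < k" "\<Theta> < real k * T"
  shows "demand (Suc i) * \<Theta> < demand i"
proof (cases "Suc i < k")
  case True
  have "demand i = demand (Suc i) * (real k * T + 1)"
    using assms True by (simp add: demand_def Suc_diff_Suc[symmetric])
  then show ?thesis
    using demand_pos[OF True] assms by simp
next
  case False
  then show ?thesis
    using demand_pos[OF assms(1)] by (simp add: demand_def)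
qed

lemma edge_cases:
  assumes "e < 3 * k"
  obtains (spine) "e < k" | (tooth) i where "i < k" "e = k + i" | (aux) i where "i < k" "e = 2 * k + i"
proof -
  consider "e < k" | "k \<le> e" "e < 2 * k" | "2 * k \<le> e"
    by linarith
  then show ?thesis
  proof cases
    case 2
    then show ?thesis
      using tooth[of "e - k"] by simp
  next
    case 3
    then show ?thesis
      using aux[of "e - 2 * k"] assms by simp
  qed (use spine in simp)
qed

lemma left_simps [simp]:
  "i < k \<Longrightarrow> left i = i" "left (k + i) = i + 1" "left (2 * k + i) = k + 1 + i"
  by (auto simp: left_def)

lemma right_simps [simp]:
  "i < k \<Longrightarrow> right i = i + 1" "i < k \<Longrightarrow> right (k + i) = k + 1 + i" "right (2 * k + i) = z i"
  using k by (auto simp: right_def)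

lemma left_neq_right: "e < 3 * k \<Longrightarrow> left e \<noteq> right e"
  using z(1) by (elim edge_cases) fastforce+

lemma left_right_less: "e < 3 * k \<Longrightarrow> left e < n \<and> right e < n"
  using n z(2) by (elim edge_cases) auto

lemma sum_edges:
  fixes g :: "nat \<Rightarrow> real"
  shows "(\<Sum>e<3 * k. g e) = (\<Sum>i<k. g i + g (k + i) + g (2 * k + i))"
proof -
  have "(\<Sum>e<3 * k. g e) = (\<Sum>m<3. \<Sum>e = m * k..<m * k + k. g e)"
    by (rule sum.nat_group[symmetric])
  also have "\<dots> = (\<Sum>m<3. \<Sum>i<k. g (m * k + i))"
    by (subst sum.atLeastLessThan_shift_0) (simp add: atLeast0LessThan)
  finally show ?thesis
    by (simp add: eval_nat_numeral sum.distrib add.assoc)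
qed

lemma demand_at_sink: "i < k \<Longrightarrow> demand_at (k + 1 + i) = demand i"
  by (simp add: demand_at_def)

lemma demand_at_other: "v \<le> k \<or> 2 * k < v \<Longrightarrow> demand_at v = 0"
  unfolding demand_at_def by (intro sum.neutral) auto

lemma supply_at_other:
  assumes "0 < v" "v \<le> 2 * k"
  shows "supply_at v = 0"
proof -
  have "z i \<noteq> v" if "i < k" for i
    using z(1)[OF that] assms by auto
  then show ?thesis
    using assms by (simp add: supply_at_def)
qed

lemma supply_at_nonneg: "0 \<le> supply_at v"
  unfolding supply_at_def by (auto intro!: add_nonneg_nonneg sum_nonneg)

lemma supply_at_0: "0 < supply_at 0"
  unfolding supply_at_def using demand_pos[OF k] by (auto intro!: add_pos_nonneg sum_nonneg)

text \<open>No node has both supply and demand, so the sign of a balance can be read off from the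
  case.\<close>

lemma supply_demand_cases:
  obtains (sink) i where "i < k" "v = k + 1 + i" "demand_at v = demand i" "supply_at v = 0"
  | (other) "v \<le> k \<or> 2 * k < v" "demand_at v = 0" "0 \<le> supply_at v"
proof (cases "v \<le> k \<or> 2 * k < v")
  case True
  then show ?thesis
    using other demand_at_other supply_at_nonneg by blast
next
  case False
  define i where "i = v - (k + 1)"
  have i: "i < k" "v = k + 1 + i"
    using False by (auto simp: i_def)
  show ?thesis
    using sink[OF i] demand_at_sink[OF i(1)] supply_at_other[of v] False i by simp
qed

lemma sum_balance: "(\<Sum>v<n. supply_at v - demand_at v) = 0"
proof -
  have "(\<Sum>v<n. supply_at v) = demand 0 + (\<Sum>i<k. demand (Suc i))"
    unfolding supply_at_def using n z(2)
    by (simp add: sum.distrib sum.swap[of _ "{..<k}"])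
  moreover have "(\<Sum>v<n. demand_at v) = (\<Sum>i<k. demand i)"
    unfolding demand_at_def using n by (subst sum.swap) (auto intro!: sum.cong)
  moreover have "(\<Sum>i<k. demand (Suc i) - demand i) = - demand 0"
    by (subst sum_lessThan_telescope) simp
  ultimately show ?thesis
    by (simp add: sum_subtractf)
qed

lemma is_undirected_network_net: "is_undirected_network net"
  unfolding is_undirected_network_def finite_multigraph_def
  using left_neq_right left_right_less sum_balance T by auto

lemma sinks_net: "sinks net = {k + 1..2 * k}"
proof -
  have "v \<in> sinks net \<longleftrightarrow> v \<in> {k + 1..2 * k}" for v
    by (cases v rule: supply_demand_cases)
      (use n demand_pos in \<open>auto simp: sinks_def\<close>)
  then show ?thesis
    by blast
qed

subsection \<open>The undirected flow\<close>

text \<open>A spine node has a smaller number than its sink, so \<open>v < w\<close> on a tooth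
  means delivery to the sink and the other direction means relaying.\<close>

definition amount :: "nat \<times> nat \<times> nat \<Rightarrow> real" where
  "amount = (\<lambda>(e, v, w).
     if e < k then (if v < w then demand e else 0)
     else if e < 2 * k then (if v < w then demand (e - k) else demand (e - k + 1))
     else if v = z (e - 2 * k) then demand (e - 2 * k + 1) else 0)"

text \<open>Relaying and the spine edges act during the first time unit; delivery waits until the
  spine flow arrives at time \<open>T\<close>.\<close>

definition start :: "nat \<times> nat \<times> nat \<Rightarrow> real" where
  "start = (\<lambda>(e, v, w). if k \<le> e \<and> e < 2 * k \<and> v < w then T else 0)"

definition rate :: "nat \<times> nat \<times> nat \<Rightarrow> real \<Rightarrow> real" where
  "rate a \<theta> = amount a * indicator {start a..<start a + 1} \<theta>"

definition ramp :: "real \<Rightarrow> real" where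
  "ramp \<theta> = max 0 (min 1 \<theta>)"

lemma cumulative_rate: "cumulative (rate a) \<theta> = amount a * ramp (\<theta> - start a)"
  unfolding rate_def[abs_def] ramp_def
  by (rule cumulative_pulse) (use T in \<open>auto simp: start_def split: prod.split\<close>)

lemma amount_nonneg: "0 \<le> amount a"
  by (auto simp: amount_def split: prod.split)

text \<open>A sink passes on the auxiliary inflow at once, and a spine node passes arriving spine
  flow to its sink and relayed flow to the next spine edge. Only the node's own supply and demand
  remain.\<close>

lemma excess_rate:
  "excess (bidirected net) rate v \<theta> = demand_at v * ramp (\<theta> - T) - supply_at v * ramp \<theta>"
proof -
  \<comment> \<open>At \<open>v\<close>, spine edge \<open>i\<close> takes \<open>d i\<close> away
    and tooth \<open>i\<close> relays \<open>d (Suc i)\<close>. The sum telescopes to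
    \<open>- d 0\<close>, the additional supply of node 0.\<close>
  define d where "d i = (if i = v then demand i * ramp \<theta> else 0)" for i
  have d_k: "d k = 0"
    by (simp only: d_def demand_k) simp
  define In where "In e =
      (if right e = v then cumulative (rate (e, left e, v)) (\<theta> - transit net e) else 0) +
      (if left e = v then cumulative (rate (e, right e, v)) (\<theta> - transit net e) else 0)" for e
  define Out where "Out e =
      (if left e = v then cumulative (rate (e, v, right e)) \<theta> else 0) +
      (if right e = v then cumulative (rate (e, v, left e)) \<theta> else 0)" for e
  have ends: "ends (graph net) e = {left e, right e} \<and> left e \<noteq> right e"
    if "e \<in> edges (graph net)" for e
    using that left_neq_right by simp
  have "(\<Sum>a\<in>in_arcs (graph (bidirected net)) v.
      cumulative (rate a) (\<theta> - transit (bidirected net) a)) = (\<Sum>e<3 * k. In e)"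
    by (subst sum_in_arcs_bidirected[OF _ ends]) (simp_all add: In_def bidirected_def cong: if_cong)
  moreover have "(\<Sum>a\<in>out_arcs (graph (bidirected net)) v. cumulative (rate a) \<theta>) = (\<Sum>e<3 * k. Out e)"
    by (subst sum_out_arcs_bidirected[OF _ ends]) (simp_all add: Out_def cong: if_cong)
  ultimately have "excess (bidirected net) rate v \<theta> =
      (\<Sum>i<k. (In i - Out i) + (In (k + i) - Out (k + i)) + (In (2 * k + i) - Out (2 * k + i)))"
    unfolding excess_cumulative by (simp add: sum_edges sum.distrib sum_subtractf)
  also have "\<dots> = (\<Sum>i<k. (if k + 1 + i = v then demand i else 0) * ramp (\<theta> - T) -
      (if z i = v then demand (Suc i) else 0) * ramp \<theta> + (d (Suc i) - d i))"
  proof (rule sum.cong)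
    fix i assume "i \<in> {..<k}"
    then have i: "i < k"
      by simp
    have spine: "In i - Out i =
        (if i + 1 = v then demand i * ramp (\<theta> - T) else 0) - (if i = v then demand i * ramp \<theta> else 0)"
      using i by (auto simp: In_def Out_def cumulative_rate amount_def start_def)
    have tooth: "In (k + i) - Out (k + i) =
        (if k + 1 + i = v then demand i * ramp (\<theta> - T) - demand (Suc i) * ramp \<theta> else 0) +
        (if i + 1 = v then demand (Suc i) * ramp \<theta> - demand i * ramp (\<theta> - T) else 0)"
      using i by (auto simp: In_def Out_def cumulative_rate amount_def start_def)
    have aux: "In (2 * k + i) - Out (2 * k + i) =
        (if k + 1 + i = v then demand (Suc i) * ramp \<theta> else 0) -
        (if z i = v then demand (Suc i) * ramp \<theta> else 0)"
      using i z(1)[OF i] by (auto simp: In_def Out_def cumulative_rate amount_def start_def)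
    show "(In i - Out i) + (In (k + i) - Out (k + i)) + (In (2 * k + i) - Out (2 * k + i)) =
        (if k + 1 + i = v then demand i else 0) * ramp (\<theta> - T) -
        (if z i = v then demand (Suc i) else 0) * ramp \<theta> + (d (Suc i) - d i)"
      unfolding spine tooth aux d_def by auto
  qed simp
  also have "\<dots> = demand_at v * ramp (\<theta> - T) -
      (\<Sum>i<k. if z i = v then demand (Suc i) else 0) * ramp \<theta> + (d k - d 0)"
    unfolding sum.distrib sum_lessThan_telescope
    by (simp add: sum_subtractf sum_distrib_right demand_at_def)
  also have "\<dots> = demand_at v * ramp (\<theta> - T) - supply_at v * ramp \<theta>"
    using d_k by (simp add: supply_at_def d_def algebra_simps)
  finally show ?thesis .
qed

lemma undirected_can_send_net: "undirected_can_send net (total_supply net) (T + 1)"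
proof -
  let ?N = "bidirected net"
  have V: "verts (graph ?N) = {..<n}" "balance ?N v = supply_at v - demand_at v" for v
    by (simp_all add: bidirected_def)
  have arc: "set_integrable lebesgue {0..<T + 1} (rate a) \<and>
      (\<forall>\<theta>\<in>{0..<T + 1}. 0 \<le> rate a \<theta> \<and> ereal (rate a \<theta>) \<le> capacity ?N a \<and>
         (T + 1 - transit ?N a \<le> \<theta> \<longrightarrow> rate a \<theta> = 0))"
    if "a \<in> arcs (graph ?N)" for a
  proof (intro conjI ballI impI)
    have finite_Ico: "emeasure lborel {x..<y :: real} < top" for x y
      by (cases "x \<le> y") auto
    show "set_integrable lebesgue {0..<T + 1} (rate a)"
      unfolding rate_def[abs_def] by (intro set_integrable_mult_right)
        (auto simp: set_integrable_def indicator_inter_arith[symmetric] finite_Ico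
          intro!: integrable_real_indicator)
    fix \<theta> assume \<theta>: "\<theta> \<in> {0..<T + 1}"
    show "0 \<le> rate a \<theta>"
      using amount_nonneg by (simp add: rate_def)
    show "ereal (rate a \<theta>) \<le> capacity ?N a"
      using that by (auto simp: bidirected_def rate_def amount_def indicator_def)
    \<comment> \<open>Only spine edges have positive transit time, and their pulses end at time 1,
      exactly \<open>T\<close> before the horizon.\<close>
    show "rate a \<theta> = 0" if "T + 1 - transit ?N a \<le> \<theta>"
      using that \<theta>
      by (auto simp: bidirected_def rate_def start_def indicator_def split: prod.splits if_splits)
  qed
  have ramp: "0 \<le> ramp \<theta>" "ramp \<theta> \<le> 1" for \<theta>
    by (auto simp: ramp_def)
  have ramp_1: "ramp (T + 1) = 1" "ramp 1 = 1"
    using T by (auto simp: ramp_def)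
  have node: "(balance ?N v = 0 \<longrightarrow>
         (\<forall>\<theta>\<in>{0..T + 1}. 0 \<le> excess ?N rate v \<theta>) \<and> excess ?N rate v (T + 1) = 0) \<and>
       (0 < balance ?N v \<longrightarrow>
         (\<forall>\<theta>\<in>{0..T + 1}. 0 \<le> - excess ?N rate v \<theta> \<and> - excess ?N rate v \<theta> \<le> balance ?N v)) \<and>
       (balance ?N v < 0 \<longrightarrow>
         (\<forall>\<theta>\<in>{0..T + 1}. 0 \<le> excess ?N rate v \<theta> \<and> excess ?N rate v \<theta> \<le> - balance ?N v))" for v
  proof (cases v rule: supply_demand_cases)
    case (sink i)
    have "0 \<le> demand i * ramp x" "demand i * ramp x \<le> demand i" for x
      using ramp by (simp_all add: mult_left_le)
    then show ?thesis
      using sink demand_pos[OF sink(1)] ramp_1 by (simp add: V excess_rate)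
  next
    case other
    have "0 \<le> supply_at v * ramp x" "supply_at v * ramp x \<le> supply_at v" for x
      using ramp other by (simp_all add: mult_left_le)
    then show ?thesis
      using other by (auto simp: V excess_rate)
  qed
  have "0 \<le> T + 1"
    using T by simp
  then have "flow_over_time ?N (T + 1) rate"
    unfolding flow_over_time_def using arc node by blast
  \<comment> \<open>One pulse already fills an auxiliary edge; as \<open>v\<close> and
    \<open>w\<close> differ, only the direction out of the auxiliary source carries it.\<close>
  moreover have "ereal (rate (e, v, w) \<theta> + rate (e, w, v) \<theta>) \<le> capacity net e"
    if "e \<in> edges (graph net)" "ends (graph net) e = {v, w}" for e v w \<theta>
  proof -
    have "v \<noteq> w"
      using that left_neq_right[of e] by auto
    then show ?thesis
      by (auto simp: rate_def amount_def indicator_def)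
  qed
  ultimately have "undirected_flow_over_time net (T + 1) rate"
    unfolding undirected_flow_over_time_def by blast
  moreover have "excess ?N rate v (T + 1) = - balance ?N v" for v
    using ramp_1 by (simp add: excess_rate V)
  \<comment> \<open>The value appears as the total demand, which is the supply of the negated
    network.\<close>
  then have "flow_value ?N (T + 1) rate = total_supply (negate net)"
    by (simp add: flow_value_def total_supply_def sources_def V)
  ultimately show ?thesis
    unfolding undirected_can_send_def
    using total_supply_negate[OF is_undirected_network_net] by auto
qed

subsection \<open>Orientations\<close>

lemma orientation_horizon:
  assumes D: "is_orientation net D" and send: "can_send D (total_supply net) \<Theta>"
  shows "real k * T \<le> \<Theta>"
proof (rule ccontr)
  assume "\<not> real k * T \<le> \<Theta>"
  then have \<Theta>_less: "\<Theta> < real k * T"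
    by simp
  obtain f where f: "flow_over_time D \<Theta> f" "flow_value D \<Theta> f = supply_of D"
    using send supply_of_orientation[OF D] by (auto simp: can_send_def)
  have wf: "wf_network D"
    by (rule wf_network_orientation[OF is_undirected_network_net D])
  note sat = excess_saturated[OF wf f]
  have \<Theta>: "0 \<le> \<Theta>"
    using f by (auto simp: flow_over_time_def)
  have G: "verts (graph D) = {..<n}" "arcs (graph D) = {..<3 * k}"
    and bal: "balance D = balance net" and transit: "transit D = transit net"
    and ends: "\<And>e. e < 3 * k \<Longrightarrow> {tail (graph D) e, head (graph D) e} = {left e, right e}"
    using D by (auto simp: is_orientation_def)
  have orient: "head (graph D) e = left e \<and> tail (graph D) e = right e \<or>
      head (graph D) e = right e \<and> tail (graph D) e = left e" if "e < 3 * k" for e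
    using ends[OF that] by (auto simp: doubleton_eq_iff)
  have f_arc: "set_integrable lebesgue {0..<\<Theta>} (f a)" "\<And>\<theta>. \<theta> \<in> {0..<\<Theta>} \<Longrightarrow> 0 \<le> f a \<theta>"
      "\<And>\<theta>. \<theta> \<in> {0..<\<Theta>} \<Longrightarrow> ereal (f a \<theta>) \<le> capacity net a"
    if "a < 3 * k" for a
    using f(1) D that by (auto simp: flow_over_time_def G is_orientation_def)
  let ?F = "\<lambda>a. cumulative (f a)"
  have F_nonneg: "0 \<le> ?F a \<theta>" if "a < 3 * k" "\<theta> \<le> \<Theta>" for a \<theta>
    by (rule cumulative_nonneg[OF f_arc(1,2)]) (use that in auto)
  have fin: "finite (in_arcs (graph D) v)" "finite (out_arcs (graph D) v)" for v
    by (simp_all add: in_arcs_def out_arcs_def G)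
  have out_nonneg: "0 \<le> (\<Sum>a\<in>out_arcs (graph D) v. ?F a \<theta>)" if "\<theta> \<le> \<Theta>" for v \<theta>
    by (rule sum_nonneg) (use that F_nonneg in \<open>auto simp: G\<close>)

  \<comment> \<open>By saturation each sink receives its full demand, more than its auxiliary edge
    can carry within \<Theta>. So its tooth points towards it and is used.\<close>
  have into_sink: "head (graph D) (k + i) = k + 1 + i \<and> 0 < ?F (k + i) \<Theta>" if i: "i < k" for i
  proof (rule ccontr)
    assume neg: "\<not> ?thesis"
    let ?v = "k + 1 + i"
    have "demand i = excess D f ?v \<Theta>"
      using sat[of ?v] i n demand_at_sink[OF i] supply_at_other[of ?v] by (simp add: G bal)
    also have "\<dots> \<le> (\<Sum>a\<in>in_arcs (graph D) ?v. ?F a (\<Theta> - transit D a))"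
      unfolding excess_cumulative using out_nonneg by simp
    \<comment> \<open>If the claim fails, the tooth either leaves the sink or carries nothing, and
      only the auxiliary edge can contribute.\<close>
    also have "\<dots> \<le> (\<Sum>a\<in>in_arcs (graph D) ?v. if a = 2 * k + i then ?F (2 * k + i) \<Theta> else 0)"
    proof (rule sum_mono)
      fix a assume a: "a \<in> in_arcs (graph D) ?v"
      then have "a < 3 * k" "left a = ?v \<or> right a = ?v"
        using orient[of a] by (auto simp: G)
      then have "a = k + i \<or> a = 2 * k + i"
        using z(1) i by (elim edge_cases) force+
      then show "?F a (\<Theta> - transit D a) \<le> (if a = 2 * k + i then ?F (2 * k + i) \<Theta> else 0)"
        using a neg k by (auto simp: G transit)
    qed
    also have "\<dots> \<le> ?F (2 * k + i) \<Theta>"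
      using fin F_nonneg[of "2 * k + i" \<Theta>] i by simp
    also have "\<dots> \<le> demand (Suc i) * \<Theta>"
      by (rule cumulative_le[OF f_arc(1)]) (use i \<Theta> f_arc(3)[of "2 * k + i"] in auto)
    also have "\<dots> < demand i"
      by (rule demand_Suc[OF i \<Theta>_less])
    finally show False
      by simp
  qed

  \<comment> \<open>Flow that left spine node \<open>v\<close> by \<theta> must have entered it. Its
    tooth leads away by \<open>into_sink\<close>, and so does the next spine edge by assumption,
    which leaves the previous one, entered at least \<open>T\<close> earlier.\<close>
  have step: "head (graph D) (v - 1) = v \<and> 0 < ?F (v - 1) (\<theta> - T)"
    if v: "0 < v" "v \<le> k" and \<theta>: "\<theta> \<le> \<Theta>" and b: "b \<in> out_arcs (graph D) v" "0 < ?F b \<theta>"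
      and next_out: "v < k \<longrightarrow> head (graph D) v \<noteq> v" for v b \<theta>
  proof (rule ccontr)
    assume neg: "\<not> ?thesis"
    \<comment> \<open>In the induction the deadline drops by \<open>T\<close> each time; positive
      flow before it keeps it in the range where the excess is constrained.\<close>
    have "0 < \<theta>"
      using b(2) by (rule contrapos_pp) simp
    then have "0 \<le> excess D f v \<theta>"
      using f(1) v \<theta> n demand_at_other[of v] supply_at_other[of v]
      by (auto simp: flow_over_time_def G bal)
    moreover have "(\<Sum>a\<in>in_arcs (graph D) v. ?F a (\<theta> - transit D a)) \<le> 0"
    proof (rule sum_nonpos)
      fix a assume a: "a \<in> in_arcs (graph D) v"
      then have lt: "a < 3 * k" and "left a = v \<or> right a = v" "head (graph D) a = v"
        using orient[of a] by (auto simp: G)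
      then have "a = v - 1"
      proof (cases a rule: edge_cases)
        case spine
        then show ?thesis
          using \<open>left a = v \<or> right a = v\<close> \<open>head (graph D) a = v\<close> next_out by auto
      next
        case (tooth i)
        then show ?thesis
          using \<open>head (graph D) a = v\<close> into_sink[of i] v by auto
      next
        case (aux i)
        then show ?thesis
          using \<open>left a = v \<or> right a = v\<close> z(1)[of i] v by auto
      qed
      then show "?F a (\<theta> - transit D a) \<le> 0"
        using neg \<open>head (graph D) a = v\<close> v by (auto simp: transit)
    qed
    moreover have "?F b \<theta> \<le> (\<Sum>a\<in>out_arcs (graph D) v. ?F a \<theta>)"
      by (rule member_le_sum) (use b fin F_nonneg \<theta> in \<open>auto simp: G\<close>)
    ultimately show False
      using b(2) by (simp add: excess_cumulative)
  qed

  \<comment> \<open>The spine is traced backwards from node \<open>k\<close>, each edge moving the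
    deadline back by \<open>T\<close>. The first outgoing arc is the last tooth; later it is the
    spine edge just found, whose direction gives \<open>next_out\<close>.\<close>
  have "head (graph D) (k - 1 - m) = k - m \<and> 0 < ?F (k - 1 - m) (\<Theta> - real (Suc m) * T)"
    if "m < k" for m
    using that
  proof (induction m)
    case 0
    obtain j where j: "j < k" "Suc j = k"
      using k by (cases k) auto
    have "k + j \<in> out_arcs (graph D) k"
      using orient[of "k + j"] into_sink[of j] j by (auto simp: G)
    then show ?case
      using step[of k \<Theta> "k + j"] into_sink[of j] j by simp
  next
    case (Suc m)
    define v where "v = k - 1 - m"
    have v: "0 < v" "v < k" "k - m = v + 1" "k - 1 - Suc m = v - 1" "k - Suc m = v"
      using Suc.prems by (auto simp: v_def)
    have head: "head (graph D) v = v + 1" "0 < ?F v (\<Theta> - real (Suc m) * T)"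
      using Suc.IH Suc.prems unfolding v_def[symmetric] v(3) by auto
    then have "v \<in> out_arcs (graph D) v"
      using orient[of v] v(2) by (auto simp: G)
    moreover have "\<Theta> - real (Suc m) * T \<le> \<Theta>"
      using T by simp
    ultimately have "head (graph D) (v - 1) = v \<and> 0 < ?F (v - 1) (\<Theta> - real (Suc m) * T - T)"
      using step[of v "\<Theta> - real (Suc m) * T" v] head v(1,2) by simp
    moreover have "\<Theta> - real (Suc m) * T - T = \<Theta> - real (Suc (Suc m)) * T"
      by (simp add: algebra_simps)
    ultimately show ?case
      unfolding v(4,5) by metis
  qed
  \<comment> \<open>At the first spine edge the deadline \<Theta> - \<open>k * T\<close> is
    negative, so nothing can have entered before it.\<close>
  from this[of "k - 1"] have "0 < ?F 0 (\<Theta> - real k * T)"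
    using k by simp
  then show False
    using \<Theta>_less by simp
qed

text \<open>The node count only has to keep \<open>(n - 1) / 4\<close> below \<open>k\<close>; this
  covers both \<open>2 * k + 1\<close> and \<open>3 * k + 1\<close> nodes.\<close>

lemma price_net:
  assumes "n \<le> 4 * k + 1"
  shows "is_undirected_network net \<and> card (nodes (graph net)) = n \<and>
    undirected_can_send net (total_supply net) (T + 1) \<and>
    (\<forall>D. is_orientation net D \<longrightarrow>
       (\<forall>\<Theta>. can_send D (total_supply net) \<Theta> \<longrightarrow> (real n - 1) / 4 * T \<le> \<Theta>))"
proof -
  have "(real n - 1) / 4 * T \<le> real k * T"
    using assms T by (intro mult_right_mono) auto
  then show ?thesis
    using is_undirected_network_net undirected_can_send_net
    by (auto dest: orientation_horizon)
qed

lemma price_negate_net: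
  assumes "n \<le> 4 * k + 1"
  shows "is_undirected_network (negate net) \<and> card (nodes (graph (negate net))) = n \<and>
    undirected_can_send (negate net) (total_supply (negate net)) (T + 1) \<and>
    (\<forall>D. is_orientation (negate net) D \<longrightarrow>
       (\<forall>\<Theta>. can_send D (total_supply (negate net)) \<Theta> \<longrightarrow> (real n - 1) / 4 * T \<le> \<Theta>))"
proof -
  note N = is_undirected_network_net
  have "(real n - 1) / 4 * T \<le> \<Theta>"
    if "is_orientation (negate net) D" "can_send D (total_supply (negate net)) \<Theta>" for D \<Theta>
    using can_send_orientation_negate[OF N that] price_net[OF assms] by metis
  then show ?thesis
    using is_undirected_network_negate[OF N] undirected_can_send_negate[OF N undirected_can_send_net]
    by simp
qed

section \<open>Sources, sinks and tree shape of the comb\<close>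

lemma sources_net_single:
  assumes "\<And>i. i < k \<Longrightarrow> z i = 0"
  shows "card (sources net) = 1"
proof -
  have "supply_at v = 0" if "v \<noteq> 0" for v
    using that assms by (simp add: supply_at_def)
  moreover have "0 < balance net 0"
    using supply_at_0 demand_at_other[of 0] by simp
  moreover have "0 \<le> demand_at v" for v
    by (cases v rule: supply_demand_cases) auto
  ultimately have "sources net = {0}"
    using n by (force simp: sources_def not_less[symmetric])
  then show ?thesis
    by simp
qed

lemma two_sources_net:
  assumes "z 0 \<noteq> 0" "1 < k"
  shows "2 \<le> card (sources net)"
proof -
  \<comment> \<open>The auxiliary source of sink number 0 supplies at least \<open>demand 1\<close>,
    which is positive since \<open>1 < k\<close>.\<close>
  have "demand 1 \<le> (\<Sum>i<k. if z i = z 0 then demand (Suc i) else 0)"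
    using member_le_sum[of 0 "{..<k}" "\<lambda>i. if z i = z 0 then demand (Suc i) else 0"] k by simp
  then have "0 < balance net (z 0)"
    using demand_pos[OF assms(2)] z(1)[OF k] assms(1) demand_at_other[of "z 0"]
    by (simp add: supply_at_def)
  moreover have "0 < balance net 0"
    using supply_at_0 demand_at_other[of 0] by simp
  ultimately have "{0, z 0} \<subseteq> sources net"
    using z(2)[OF k] n by (simp add: sources_def)
  moreover have "finite (sources net)"
    by (simp add: sources_def)
  ultimately have "card {0, z 0} \<le> card (sources net)"
    by (intro card_mono)
  then show ?thesis
    using assms(1) by simp
qed

lemma two_sinks_net: "1 < k \<Longrightarrow> 2 \<le> card (sinks net)"
  unfolding sinks_net by simp

text \<open>Numbering the auxiliary leaves right after the sinks makes \<open>Suc e\<close> an end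
  of every edge \<open>e\<close>, with \<open>left\<close> as the parent function.\<close>

lemma is_tree_net:
  assumes "n = 3 * k + 1" "\<And>i. i < k \<Longrightarrow> z i = 2 * k + 1 + i"
  shows "is_tree (graph net)"
proof (rule is_tree_parent[of _ "3 * k" left])
  show "left e \<le> e" for e
    using k by (cases "e < k") (simp_all add: left_def)
  show "ends (graph net) e = {left e, Suc e}" if "e < 3 * k" for e
    using that assms(2) by (elim edge_cases) auto
qed (simp_all, simp add: assms(1))

end

section \<open>The three families\<close>

theorem theorem4:
  shows "\<forall>P \<in> {\<lambda>N :: (nat, nat) undirected_network. card (sources N) = 1,
                \<lambda>N. card (sinks N) = 1,
                \<lambda>N. is_tree (graph N) \<and> 2 \<le> card (sources N) \<and> 2 \<le> card (sinks N)}.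
    \<forall>n0 :: nat. \<exists>n \<ge> n0. \<forall>T :: real. 0 < T \<longrightarrow>
      (\<exists>N. is_undirected_network N \<and> card (nodes (graph N)) = n \<and> P N \<and>
           undirected_can_send N (total_supply N) (T + 1) \<and>
           (\<forall>D. is_orientation N D \<longrightarrow>
              (\<forall>\<Theta>. can_send D (total_supply N) \<Theta> \<longrightarrow> (real n - 1) / 4 * T \<le> \<Theta>)))"
proof (intro ballI allI)
  fix P :: "(nat, nat) undirected_network \<Rightarrow> bool" and n0 :: nat
  assume "P \<in> {\<lambda>N. card (sources N) = 1, \<lambda>N. card (sinks N) = 1,
    \<lambda>N. is_tree (graph N) \<and> 2 \<le> card (sources N) \<and> 2 \<le> card (sinks N)}"
  then consider (source) "P = (\<lambda>N. card (sources N) = 1)" | (sink) "P = (\<lambda>N. card (sinks N) = 1)"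
    | (tree) "P = (\<lambda>N. is_tree (graph N) \<and> 2 \<le> card (sources N) \<and> 2 \<le> card (sinks N))"
    by blast
  then show "\<exists>n\<ge>n0. \<forall>T :: real. 0 < T \<longrightarrow>
      (\<exists>N. is_undirected_network N \<and> card (nodes (graph N)) = n \<and> P N \<and>
           undirected_can_send N (total_supply N) (T + 1) \<and>
           (\<forall>D. is_orientation N D \<longrightarrow>
              (\<forall>\<Theta>. can_send D (total_supply N) \<Theta> \<longrightarrow> (real n - 1) / 4 * T \<le> \<Theta>)))"
  proof cases
    case source
    \<comment> \<open>The spine has \<open>n0 + 1\<close> edges and all auxiliary sources coincide
      with node 0. The node count is chosen before \<open>T\<close>, which affects only transit
      times, capacities and balances.\<close>
    show ?thesis
    proof (intro exI[of _ "2 * (n0 + 1) + 1"] conjI allI impI)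
      fix T :: real assume "0 < T"
      then have comb: "comb (n0 + 1) (2 * (n0 + 1) + 1) T (\<lambda>_. 0)"
        by unfold_locales auto
      show "\<exists>N. is_undirected_network N \<and> card (nodes (graph N)) = 2 * (n0 + 1) + 1 \<and> P N \<and>
           undirected_can_send N (total_supply N) (T + 1) \<and>
           (\<forall>D. is_orientation N D \<longrightarrow> (\<forall>\<Theta>. can_send D (total_supply N) \<Theta> \<longrightarrow>
              (real (2 * (n0 + 1) + 1) - 1) / 4 * T \<le> \<Theta>))"
        unfolding source using comb.price_net[OF comb] comb.sources_net_single[OF comb] by fastforce
    qed simp
  next
    case sink
    show ?thesis
    proof (intro exI[of _ "2 * (n0 + 1) + 1"] conjI allI impI)
      fix T :: real assume "0 < T"
      then have comb: "comb (n0 + 1) (2 * (n0 + 1) + 1) T (\<lambda>_. 0)"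
        by unfold_locales auto
      show "\<exists>N. is_undirected_network N \<and> card (nodes (graph N)) = 2 * (n0 + 1) + 1 \<and> P N \<and>
           undirected_can_send N (total_supply N) (T + 1) \<and>
           (\<forall>D. is_orientation N D \<longrightarrow> (\<forall>\<Theta>. can_send D (total_supply N) \<Theta> \<longrightarrow>
              (real (2 * (n0 + 1) + 1) - 1) / 4 * T \<le> \<Theta>))"
        unfolding sink using comb.price_negate_net[OF comb] comb.sources_net_single[OF comb]
        by (fastforce simp: sinks_negate[symmetric])
    qed simp
  next
    case tree
    \<comment> \<open>Each auxiliary source is a leaf of its own, which gives
      \<open>3 * k + 1\<close> nodes; \<open>k = n0 + 2\<close> ensures a second source and a second
      sink.\<close>
    show ?thesis
    proof (intro exI[of _ "3 * (n0 + 2) + 1"] conjI allI impI)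
      fix T :: real assume "0 < T"
      then have comb: "comb (n0 + 2) (3 * (n0 + 2) + 1) T (\<lambda>i. 2 * (n0 + 2) + 1 + i)"
        by unfold_locales auto
      show "\<exists>N. is_undirected_network N \<and> card (nodes (graph N)) = 3 * (n0 + 2) + 1 \<and> P N \<and>
           undirected_can_send N (total_supply N) (T + 1) \<and>
           (\<forall>D. is_orientation N D \<longrightarrow> (\<forall>\<Theta>. can_send D (total_supply N) \<Theta> \<longrightarrow>
              (real (3 * (n0 + 2) + 1) - 1) / 4 * T \<le> \<Theta>))"
        unfolding tree using comb.price_net[OF comb] comb.is_tree_net[OF comb]
          comb.two_sources_net[OF comb] comb.two_sinks_net[OF comb] by fastforce
    qed simp
  qed
qed

end
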